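(* Let $L$ be either of the sequent calculi $\mathrm{lTS4}$ or $\mathrm{gTS4}$ defined in the context. Then the rule (cut) is admissible in cut-free $L$; that is, every sequent provable in $L$ is provable in $L$ without using (cut).
   Context: Formulas are built from countably many propositional variables using the binary connectives $\wedge,\vee,\to$ and the unary connectives $\neg,\Box,\Diamond$. Letters $\Gamma,\Delta$ (possibly with subscripts) denote finite, possibly empty, sets of formulas; a sequent is an expression $\Gamma\Rightarrow\Delta$; a comma denotes union. For a word $w$ over $\{\neg,\Box,\Diamond\}$, $w\Gamma=\{w\gamma:\gamma\in\Gamma\}$. A rule "$S_1;\dots;S_n\,/\,S$" has premises $S_1,\dots,S_n$ and conclusion $S$. "Cut-free $L$" means the system $L$ with the rule (cut) removed. A rule $R$ is admissible in a calculus $M$ if for every instance of $R$ with premises $S_1,\dots,S_n$ and conclusion $S$, whenever every $S_i$ is provable in $M$, $S$ is provable in $M$. The calculus lTS4. Initial sequents: for every propositional variable $p$: $p\Rightarrow p$, $\neg p\Rightarrow\neg p$, $\neg p,p\Rightarrow$, and $\Rightarrow\neg p,p$. Structural rules: (cut) $\Gamma\Rightarrow\alpha$; $\alpha,\Gamma\Rightarrow\Delta$ / $\Gamma\Rightarrow\Delta$. (we-left) $\Gamma\Rightarrow\Delta$ / $\alpha,\Gamma\Rightarrow\Delta$. (we-right) $\Gamma\Rightarrow\Delta$ / $\Gamma\Rightarrow\Delta,\alpha$. Non-twist logical rules: ($\wedge$left) $\alpha,\beta,\Gamma\Rightarrow\Delta$ / $\alpha\wedge\beta,\Gamma\Rightarrow\Delta$.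 ($\wedge$right) $\Gamma\Rightarrow\Delta,\alpha$; $\Gamma\Rightarrow\Delta,\beta$ / $\Gamma\Rightarrow\Delta,\alpha\wedge\beta$. ($\vee$left) $\alpha,\Gamma\Rightarrow\Delta$; $\beta,\Gamma\Rightarrow\Delta$ / $\alpha\vee\beta,\Gamma\Rightarrow\Delta$. ($\vee$right) $\Gamma\Rightarrow\Delta,\alpha,\beta$ / $\Gamma\Rightarrow\Delta,\alpha\vee\beta$. ($\to$left) $\Gamma\Rightarrow\Delta,\alpha$; $\beta,\Gamma\Rightarrow\Delta$ / $\alpha\to\beta,\Gamma\Rightarrow\Delta$. ($\to$right) $\alpha,\Gamma\Rightarrow\Delta,\beta$ / $\Gamma\Rightarrow\Delta,\alpha\to\beta$. ($\Box$left) $\alpha,\Gamma\Rightarrow\Delta$ / $\Box\alpha,\Gamma\Rightarrow\Delta$. ($\Box$right) $\Box\Gamma_1,\neg\Diamond\Gamma_2\Rightarrow\Diamond\Delta_1,\neg\Box\Delta_2,\alpha$ / $\Box\Gamma_1,\neg\Diamond\Gamma_2\Rightarrow\Diamond\Delta_1,\neg\Box\Delta_2,\Box\alpha$. ($\Diamond$left) $\alpha,\Box\Gamma_1,\neg\Diamond\Gamma_2\Rightarrow\Diamond\Delta_1,\neg\Box\Delta_2$ / $\Diamond\alpha,\Box\Gamma_1,\neg\Diamond\Gamma_2\Rightarrow\Diamond\Delta_1,\neg\Box\Delta_2$. ($\Diamond$right) $\Gamma\Rightarrow\Delta,\alpha$ / $\Gamma\Rightarrow\Delta,\Diamond\alpha$.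 Twist rules: ($\neg\neg$left$^t$) $\alpha,\Gamma\Rightarrow\Delta$ / $\neg\neg\alpha,\Gamma\Rightarrow\Delta$. ($\neg\neg$right$^t$) $\Gamma\Rightarrow\Delta,\alpha$ / $\Gamma\Rightarrow\Delta,\neg\neg\alpha$. ($\neg\wedge$left$^t$) $\Gamma\Rightarrow\Delta,\alpha$; $\Gamma\Rightarrow\Delta,\beta$ / $\neg(\alpha\wedge\beta),\Gamma\Rightarrow\Delta$. ($\neg\wedge$right$^t$) $\alpha,\beta,\Gamma\Rightarrow\Delta$ / $\Gamma\Rightarrow\Delta,\neg(\alpha\wedge\beta)$. ($\neg\vee$left$^t$) $\Gamma\Rightarrow\Delta,\alpha,\beta$ / $\neg(\alpha\vee\beta),\Gamma\Rightarrow\Delta$. ($\neg\vee$right$^t$) $\alpha,\Gamma\Rightarrow\Delta$; $\beta,\Gamma\Rightarrow\Delta$ / $\Gamma\Rightarrow\Delta,\neg(\alpha\vee\beta)$. ($\neg\to$left$^t$) $\alpha,\Gamma\Rightarrow\Delta,\beta$ / $\neg(\alpha\to\beta),\Gamma\Rightarrow\Delta$. ($\neg\to$right$^t$) $\Gamma\Rightarrow\Delta,\alpha$; $\beta,\Gamma\Rightarrow\Delta$ / $\Gamma\Rightarrow\Delta,\neg(\alpha\to\beta)$. ($\neg\Box$left$^t$) $\Box\Gamma_1,\neg\Diamond\Gamma_2\Rightarrow\Diamond\Delta_1,\neg\Box\Delta_2,\alpha$ / $\neg\Box\alpha,\Box\Gamma_1,\neg\Diamond\Gamma_2\Rightarrow\Diamond\Delta_1,\neg\Box\Delta_2$.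 ($\neg\Box$right$^t$) $\alpha,\Gamma\Rightarrow\Delta$ / $\Gamma\Rightarrow\Delta,\neg\Box\alpha$. ($\neg\Diamond$left$^t$) $\Gamma\Rightarrow\Delta,\alpha$ / $\neg\Diamond\alpha,\Gamma\Rightarrow\Delta$. ($\neg\Diamond$right$^t$) $\alpha,\Box\Gamma_1,\neg\Diamond\Gamma_2\Rightarrow\Diamond\Delta_1,\neg\Box\Delta_2$ / $\Box\Gamma_1,\neg\Diamond\Gamma_2\Rightarrow\Diamond\Delta_1,\neg\Box\Delta_2,\neg\Diamond\alpha$. The calculus gTS4 is obtained from lTS4 by replacing ($\Box$right), ($\Diamond$left), ($\neg\Box$left$^t$), ($\neg\Diamond$right$^t$) with: ($\Box$right$^T$) $\Box\Gamma_1,\Box\Delta_2\Rightarrow\Diamond\Delta_1,\Diamond\Gamma_2,\alpha$ / $\Box\Gamma_1,\neg\Diamond\Gamma_2\Rightarrow\Diamond\Delta_1,\neg\Box\Delta_2,\Box\alpha$. ($\Diamond$left$^T$) $\alpha,\Box\Gamma_1,\Box\Delta_2\Rightarrow\Diamond\Delta_1,\Diamond\Gamma_2$ / $\Diamond\alpha,\Box\Gamma_1,\neg\Diamond\Gamma_2\Rightarrow\Diamond\Delta_1,\neg\Box\Delta_2$. ($\neg\Box$left$^T$) $\Box\Gamma_1,\Box\Delta_2\Rightarrow\Diamond\Delta_1,\Diamond\Gamma_2,\alpha$ / $\neg\Box\alpha,\Box\Gamma_1,\neg\Diamond\Gamma_2\Rightarrow\Diamond\Delta_1,\neg\Box\Delta_2$.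 ($\neg\Diamond$right$^T$) $\alpha,\Box\Gamma_1,\Box\Delta_2\Rightarrow\Diamond\Delta_1,\Diamond\Gamma_2$ / $\Box\Gamma_1,\neg\Diamond\Gamma_2\Rightarrow\Diamond\Delta_1,\neg\Box\Delta_2,\neg\Diamond\alpha$. (All other rules and initial sequents of lTS4, including ($\neg\Diamond$left$^t$), are kept.) *)

theory Defs
  imports Main "HOL-Library.FSet"
begin

datatype fm =
    Var nat
  | Conj fm fm  (infixr "\<^bold>\<and>" 75)
  | Disj fm fm  (infixr "\<^bold>\<or>" 74)
  | Imp fm fm   (infixr "\<^bold>\<rightarrow>" 73)
  | Neg fm      ("\<^bold>\<not> _" [80] 80)
  | Box fm      ("\<^bold>\<box> _" [80] 80)
  | Dia fm      ("\<^bold>\<diamond> _" [80] 80)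

datatype sequent = Sequent "fm fset" "fm fset"  (infix "\<^bold>\<Rightarrow>" 55)

abbreviation boxes :: "fm fset \<Rightarrow> fm fset" where
  "boxes \<Gamma> \<equiv> (\<lambda>\<gamma>. \<^bold>\<box> \<gamma>) |`| \<Gamma>"

abbreviation dias :: "fm fset \<Rightarrow> fm fset" where
  "dias \<Gamma> \<equiv> (\<lambda>\<gamma>. \<^bold>\<diamond> \<gamma>) |`| \<Gamma>"

abbreviation neg_boxes :: "fm fset \<Rightarrow> fm fset" where
  "neg_boxes \<Gamma> \<equiv> (\<lambda>\<gamma>. \<^bold>\<not> \<^bold>\<box> \<gamma>) |`| \<Gamma>"

abbreviation neg_dias :: "fm fset \<Rightarrow> fm fset" where
  "neg_dias \<Gamma> \<equiv> (\<lambda>\<gamma>. \<^bold>\<not> \<^bold>\<diamond> \<gamma>) |`| \<Gamma>"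

text \<open>
  Rules are named, and a calculus is a set of rule names. Removing (cut) thus removes the
  rule and not its individual instances, some of which are also instances of other rules
  (for example of the left rule for implication, when the principal formula already
  belongs to the context). Initial sequents are rules without premises.
\<close>

datatype rule =
    InitPos | InitNeg | InitLeft | InitRight
  | Cut | WeLeft | WeRight
  | ConjLeft | ConjRight | DisjLeft | DisjRight | ImpLeft | ImpRight
  | BoxLeft | BoxRight | DiaLeft | DiaRight
  | NegNegLeft | NegNegRight | NegConjLeft | NegConjRight
  | NegDisjLeft | NegDisjRight | NegImpLeft | NegImpRight
  | NegBoxLeft | NegBoxRight | NegDiaLeft | NegDiaRight
  | BoxRightT | DiaLeftT | NegBoxLeftT | NegDiaRightT

inductive instance_of :: "rule \<Rightarrow> sequent list \<Rightarrow> sequent \<Rightarrow> bool" where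
  init_pos: "instance_of InitPos [] ({|Var p|} \<^bold>\<Rightarrow> {|Var p|})"
| init_neg: "instance_of InitNeg [] ({|\<^bold>\<not> Var p|} \<^bold>\<Rightarrow> {|\<^bold>\<not> Var p|})"
| init_left: "instance_of InitLeft [] ({|\<^bold>\<not> Var p, Var p|} \<^bold>\<Rightarrow> {||})"
| init_right: "instance_of InitRight [] ({||} \<^bold>\<Rightarrow> {|\<^bold>\<not> Var p, Var p|})"

| cut: "instance_of Cut
    [\<Gamma> \<^bold>\<Rightarrow> {|\<alpha>|}, finsert \<alpha> \<Gamma> \<^bold>\<Rightarrow> \<Delta>]
    (\<Gamma> \<^bold>\<Rightarrow> \<Delta>)"
| we_left: "instance_of WeLeft
    [\<Gamma> \<^bold>\<Rightarrow> \<Delta>]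
    (finsert \<alpha> \<Gamma> \<^bold>\<Rightarrow> \<Delta>)"
| we_right: "instance_of WeRight
    [\<Gamma> \<^bold>\<Rightarrow> \<Delta>]
    (\<Gamma> \<^bold>\<Rightarrow> finsert \<alpha> \<Delta>)"

| conj_left: "instance_of ConjLeft
    [finsert \<alpha> (finsert \<beta> \<Gamma>) \<^bold>\<Rightarrow> \<Delta>]
    (finsert (\<alpha> \<^bold>\<and> \<beta>) \<Gamma> \<^bold>\<Rightarrow> \<Delta>)"
| conj_right: "instance_of ConjRight
    [\<Gamma> \<^bold>\<Rightarrow> finsert \<alpha> \<Delta>, \<Gamma> \<^bold>\<Rightarrow> finsert \<beta> \<Delta>]
    (\<Gamma> \<^bold>\<Rightarrow> finsert (\<alpha> \<^bold>\<and> \<beta>) \<Delta>)"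
| disj_left: "instance_of DisjLeft
    [finsert \<alpha> \<Gamma> \<^bold>\<Rightarrow> \<Delta>, finsert \<beta> \<Gamma> \<^bold>\<Rightarrow> \<Delta>]
    (finsert (\<alpha> \<^bold>\<or> \<beta>) \<Gamma> \<^bold>\<Rightarrow> \<Delta>)"
| disj_right: "instance_of DisjRight
    [\<Gamma> \<^bold>\<Rightarrow> finsert \<alpha> (finsert \<beta> \<Delta>)]
    (\<Gamma> \<^bold>\<Rightarrow> finsert (\<alpha> \<^bold>\<or> \<beta>) \<Delta>)"
| imp_left: "instance_of ImpLeft
    [\<Gamma> \<^bold>\<Rightarrow> finsert \<alpha> \<Delta>, finsert \<beta> \<Gamma> \<^bold>\<Rightarrow> \<Delta>]
    (finsert (\<alpha> \<^bold>\<rightarrow> \<beta>) \<Gamma> \<^bold>\<Rightarrow> \<Delta>)"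
| imp_right: "instance_of ImpRight
    [finsert \<alpha> \<Gamma> \<^bold>\<Rightarrow> finsert \<beta> \<Delta>]
    (\<Gamma> \<^bold>\<Rightarrow> finsert (\<alpha> \<^bold>\<rightarrow> \<beta>) \<Delta>)"

| box_left: "instance_of BoxLeft
    [finsert \<alpha> \<Gamma> \<^bold>\<Rightarrow> \<Delta>]
    (finsert (\<^bold>\<box> \<alpha>) \<Gamma> \<^bold>\<Rightarrow> \<Delta>)"
| box_right: "instance_of BoxRight
    [boxes \<Gamma>\<^sub>1 |\<union>| neg_dias \<Gamma>\<^sub>2 \<^bold>\<Rightarrow> finsert \<alpha> (dias \<Delta>\<^sub>1 |\<union>| neg_boxes \<Delta>\<^sub>2)]
    (boxes \<Gamma>\<^sub>1 |\<union>| neg_dias \<Gamma>\<^sub>2 \<^bold>\<Rightarrow> finsert (\<^bold>\<box> \<alpha>) (dias \<Delta>\<^sub>1 |\<union>| neg_boxes \<Delta>\<^sub>2))"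
| dia_left: "instance_of DiaLeft
    [finsert \<alpha> (boxes \<Gamma>\<^sub>1 |\<union>| neg_dias \<Gamma>\<^sub>2) \<^bold>\<Rightarrow> dias \<Delta>\<^sub>1 |\<union>| neg_boxes \<Delta>\<^sub>2]
    (finsert (\<^bold>\<diamond> \<alpha>) (boxes \<Gamma>\<^sub>1 |\<union>| neg_dias \<Gamma>\<^sub>2) \<^bold>\<Rightarrow> dias \<Delta>\<^sub>1 |\<union>| neg_boxes \<Delta>\<^sub>2)"
| dia_right: "instance_of DiaRight
    [\<Gamma> \<^bold>\<Rightarrow> finsert \<alpha> \<Delta>]
    (\<Gamma> \<^bold>\<Rightarrow> finsert (\<^bold>\<diamond> \<alpha>) \<Delta>)"

| neg_neg_left: "instance_of NegNegLeft
    [finsert \<alpha> \<Gamma> \<^bold>\<Rightarrow> \<Delta>]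
    (finsert (\<^bold>\<not> \<^bold>\<not> \<alpha>) \<Gamma> \<^bold>\<Rightarrow> \<Delta>)"
| neg_neg_right: "instance_of NegNegRight
    [\<Gamma> \<^bold>\<Rightarrow> finsert \<alpha> \<Delta>]
    (\<Gamma> \<^bold>\<Rightarrow> finsert (\<^bold>\<not> \<^bold>\<not> \<alpha>) \<Delta>)"
| neg_conj_left: "instance_of NegConjLeft
    [\<Gamma> \<^bold>\<Rightarrow> finsert \<alpha> \<Delta>, \<Gamma> \<^bold>\<Rightarrow> finsert \<beta> \<Delta>]
    (finsert (\<^bold>\<not> (\<alpha> \<^bold>\<and> \<beta>)) \<Gamma> \<^bold>\<Rightarrow> \<Delta>)"
| neg_conj_right: "instance_of NegConjRight
    [finsert \<alpha> (finsert \<beta> \<Gamma>) \<^bold>\<Rightarrow> \<Delta>]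
    (\<Gamma> \<^bold>\<Rightarrow> finsert (\<^bold>\<not> (\<alpha> \<^bold>\<and> \<beta>)) \<Delta>)"
| neg_disj_left: "instance_of NegDisjLeft
    [\<Gamma> \<^bold>\<Rightarrow> finsert \<alpha> (finsert \<beta> \<Delta>)]
    (finsert (\<^bold>\<not> (\<alpha> \<^bold>\<or> \<beta>)) \<Gamma> \<^bold>\<Rightarrow> \<Delta>)"
| neg_disj_right: "instance_of NegDisjRight
    [finsert \<alpha> \<Gamma> \<^bold>\<Rightarrow> \<Delta>, finsert \<beta> \<Gamma> \<^bold>\<Rightarrow> \<Delta>]
    (\<Gamma> \<^bold>\<Rightarrow> finsert (\<^bold>\<not> (\<alpha> \<^bold>\<or> \<beta>)) \<Delta>)"
| neg_imp_left: "instance_of NegImpLeft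
    [finsert \<alpha> \<Gamma> \<^bold>\<Rightarrow> finsert \<beta> \<Delta>]
    (finsert (\<^bold>\<not> (\<alpha> \<^bold>\<rightarrow> \<beta>)) \<Gamma> \<^bold>\<Rightarrow> \<Delta>)"
| neg_imp_right: "instance_of NegImpRight
    [\<Gamma> \<^bold>\<Rightarrow> finsert \<alpha> \<Delta>, finsert \<beta> \<Gamma> \<^bold>\<Rightarrow> \<Delta>]
    (\<Gamma> \<^bold>\<Rightarrow> finsert (\<^bold>\<not> (\<alpha> \<^bold>\<rightarrow> \<beta>)) \<Delta>)"

| neg_box_left: "instance_of NegBoxLeft
    [boxes \<Gamma>\<^sub>1 |\<union>| neg_dias \<Gamma>\<^sub>2 \<^bold>\<Rightarrow> finsert \<alpha> (dias \<Delta>\<^sub>1 |\<union>| neg_boxes \<Delta>\<^sub>2)]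
    (finsert (\<^bold>\<not> \<^bold>\<box> \<alpha>) (boxes \<Gamma>\<^sub>1 |\<union>| neg_dias \<Gamma>\<^sub>2) \<^bold>\<Rightarrow> dias \<Delta>\<^sub>1 |\<union>| neg_boxes \<Delta>\<^sub>2)"
| neg_box_right: "instance_of NegBoxRight
    [finsert \<alpha> \<Gamma> \<^bold>\<Rightarrow> \<Delta>]
    (\<Gamma> \<^bold>\<Rightarrow> finsert (\<^bold>\<not> \<^bold>\<box> \<alpha>) \<Delta>)"
| neg_dia_left: "instance_of NegDiaLeft
    [\<Gamma> \<^bold>\<Rightarrow> finsert \<alpha> \<Delta>]
    (finsert (\<^bold>\<not> \<^bold>\<diamond> \<alpha>) \<Gamma> \<^bold>\<Rightarrow> \<Delta>)"
| neg_dia_right: "instance_of NegDiaRight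
    [finsert \<alpha> (boxes \<Gamma>\<^sub>1 |\<union>| neg_dias \<Gamma>\<^sub>2) \<^bold>\<Rightarrow> dias \<Delta>\<^sub>1 |\<union>| neg_boxes \<Delta>\<^sub>2]
    (boxes \<Gamma>\<^sub>1 |\<union>| neg_dias \<Gamma>\<^sub>2 \<^bold>\<Rightarrow> finsert (\<^bold>\<not> \<^bold>\<diamond> \<alpha>) (dias \<Delta>\<^sub>1 |\<union>| neg_boxes \<Delta>\<^sub>2))"

| box_right_T: "instance_of BoxRightT
    [boxes \<Gamma>\<^sub>1 |\<union>| boxes \<Delta>\<^sub>2 \<^bold>\<Rightarrow> finsert \<alpha> (dias \<Delta>\<^sub>1 |\<union>| dias \<Gamma>\<^sub>2)]
    (boxes \<Gamma>\<^sub>1 |\<union>| neg_dias \<Gamma>\<^sub>2 \<^bold>\<Rightarrow> finsert (\<^bold>\<box> \<alpha>) (dias \<Delta>\<^sub>1 |\<union>| neg_boxes \<Delta>\<^sub>2))"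
| dia_left_T: "instance_of DiaLeftT
    [finsert \<alpha> (boxes \<Gamma>\<^sub>1 |\<union>| boxes \<Delta>\<^sub>2) \<^bold>\<Rightarrow> dias \<Delta>\<^sub>1 |\<union>| dias \<Gamma>\<^sub>2]
    (finsert (\<^bold>\<diamond> \<alpha>) (boxes \<Gamma>\<^sub>1 |\<union>| neg_dias \<Gamma>\<^sub>2) \<^bold>\<Rightarrow> dias \<Delta>\<^sub>1 |\<union>| neg_boxes \<Delta>\<^sub>2)"
| neg_box_left_T: "instance_of NegBoxLeftT
    [boxes \<Gamma>\<^sub>1 |\<union>| boxes \<Delta>\<^sub>2 \<^bold>\<Rightarrow> finsert \<alpha> (dias \<Delta>\<^sub>1 |\<union>| dias \<Gamma>\<^sub>2)]
    (finsert (\<^bold>\<not> \<^bold>\<box> \<alpha>) (boxes \<Gamma>\<^sub>1 |\<union>| neg_dias \<Gamma>\<^sub>2) \<^bold>\<Rightarrow> dias \<Delta>\<^sub>1 |\<union>| neg_boxes \<Delta>\<^sub>2)"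
| neg_dia_right_T: "instance_of NegDiaRightT
    [finsert \<alpha> (boxes \<Gamma>\<^sub>1 |\<union>| boxes \<Delta>\<^sub>2) \<^bold>\<Rightarrow> dias \<Delta>\<^sub>1 |\<union>| dias \<Gamma>\<^sub>2]
    (boxes \<Gamma>\<^sub>1 |\<union>| neg_dias \<Gamma>\<^sub>2 \<^bold>\<Rightarrow> finsert (\<^bold>\<not> \<^bold>\<diamond> \<alpha>) (dias \<Delta>\<^sub>1 |\<union>| neg_boxes \<Delta>\<^sub>2))"

type_synonym calculus = "rule set"

inductive provable :: "calculus \<Rightarrow> sequent \<Rightarrow> bool" for M where
  rule: "R \<in> M \<Longrightarrow> instance_of R Ss S \<Longrightarrow> (\<And>S'. S' \<in> set Ss \<Longrightarrow> provable M S') \<Longrightarrow> provable M S"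

definition admissible :: "rule \<Rightarrow> calculus \<Rightarrow> bool" where
  "admissible R M \<longleftrightarrow>
    (\<forall>Ss S. instance_of R Ss S \<longrightarrow> (\<forall>S' \<in> set Ss. provable M S') \<longrightarrow> provable M S)"

definition lTS4 :: calculus where
  "lTS4 =
    {InitPos, InitNeg, InitLeft, InitRight,
     Cut, WeLeft, WeRight,
     ConjLeft, ConjRight, DisjLeft, DisjRight, ImpLeft, ImpRight,
     BoxLeft, BoxRight, DiaLeft, DiaRight,
     NegNegLeft, NegNegRight, NegConjLeft, NegConjRight,
     NegDisjLeft, NegDisjRight, NegImpLeft, NegImpRight,
     NegBoxLeft, NegBoxRight, NegDiaLeft, NegDiaRight}"

definition gTS4 :: calculus where
  "gTS4 = (lTS4 - {BoxRight, DiaLeft, NegBoxLeft, NegDiaRight})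
    \<union> {BoxRightT, DiaLeftT, NegBoxLeftT, NegDiaRightT}"

definition cut_free :: "calculus \<Rightarrow> calculus" where
  "cut_free L = L - {Cut}"

end

theory Submission
  imports Defs
begin

text \<open>
  All rules of both calculi, (cut) included, are sound for reflexive transitive Kripke models,
  so it suffices that every valid sequent has a cut-free proof. The countermodel of an underivable
  sequent has as worlds the maximal pairs \<open>(X, Y)\<close> of sets of formulas such that no
  \<open>\<Gamma> \<Rightarrow> \<Delta>\<close> with \<open>\<Gamma> \<subseteq> X\<close> and \<open>\<Delta> \<subseteq> Y\<close> is derivable without (cut).
  Accessibility preserves the set of \<open>\<gamma>\<close> with \<open>\<box>\<gamma> \<in> X\<close> or \<open>\<not>\<box>\<gamma> \<in> Y\<close>, and the set of \<open>\<gamma>\<close> with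
  \<open>\<diamond>\<gamma> \<in> Y\<close> or \<open>\<not>\<diamond>\<gamma> \<in> X\<close>. Since these sets do not distinguish \<open>\<not>\<diamond>\<gamma>\<close> on the left from \<open>\<diamond>\<gamma>\<close> on
  the right, nor \<open>\<not>\<box>\<gamma>\<close> on the right from \<open>\<box>\<gamma>\<close> on the left, the same model serves both calculi.
\<close>

section \<open>Kripke semantics and soundness of all rules\<close>

primrec sat :: "('w \<Rightarrow> 'w \<Rightarrow> bool) \<Rightarrow> ('w \<Rightarrow> nat \<Rightarrow> bool) \<Rightarrow> 'w \<Rightarrow> fm \<Rightarrow> bool" where
  "sat R V w (Var p) = V w p"
| "sat R V w (\<alpha> \<^bold>\<and> \<beta>) = (sat R V w \<alpha> \<and> sat R V w \<beta>)"
| "sat R V w (\<alpha> \<^bold>\<or> \<beta>) = (sat R V w \<alpha> \<or> sat R V w \<beta>)"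
| "sat R V w (\<alpha> \<^bold>\<rightarrow> \<beta>) = (sat R V w \<alpha> \<longrightarrow> sat R V w \<beta>)"
| "sat R V w (\<^bold>\<not> \<alpha>) = (\<not> sat R V w \<alpha>)"
| "sat R V w (\<^bold>\<box> \<alpha>) = (\<forall>v. R w v \<longrightarrow> sat R V v \<alpha>)"
| "sat R V w (\<^bold>\<diamond> \<alpha>) = (\<exists>v. R w v \<and> sat R V v \<alpha>)"

fun sat_sequent :: "('w \<Rightarrow> 'w \<Rightarrow> bool) \<Rightarrow> ('w \<Rightarrow> nat \<Rightarrow> bool) \<Rightarrow> 'w \<Rightarrow> sequent \<Rightarrow> bool" where
  "sat_sequent R V w (\<Gamma> \<^bold>\<Rightarrow> \<Delta>) \<longleftrightarrow>
    (\<forall>\<phi>\<in>fset \<Gamma>. sat R V w \<phi>) \<longrightarrow> (\<exists>\<phi>\<in>fset \<Delta>. sat R V w \<phi>)"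

text \<open>Truth of \<box>\<gamma> and falsity of \<diamond>\<gamma> persist along a transitive
  relation, so a context of a restricted modal rule that is refuted at a world stays refuted at the
  successor that witnesses the principal formula. Since \<not>\<diamond>\<gamma> on the left imposes
  the same condition as \<diamond>\<gamma> on the right, and \<not>\<box>\<gamma> on the right the
  same as \<box>\<gamma> on the left, this argument also covers the rules specific to gTS4.
  Reflexivity serves the unrestricted modal rules.\<close>

lemma instance_of_sound:
  assumes "reflp R" and "transp R" and "instance_of r Ss S"
    and "\<And>w S'. S' \<in> set Ss \<Longrightarrow> sat_sequent R V w S'"
  shows "sat_sequent R V w S"
proof -
  have box_refl: "sat R V v (\<^bold>\<box> \<gamma>) \<Longrightarrow> sat R V v \<gamma>"
    and dia_refl: "sat R V v \<gamma> \<Longrightarrow> sat R V v (\<^bold>\<diamond> \<gamma>)" for v \<gamma>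
    using assms(1) by (auto dest: reflpD)
  have box_trans: "sat R V u (\<^bold>\<box> \<gamma>) \<Longrightarrow> R u v \<Longrightarrow> sat R V v (\<^bold>\<box> \<gamma>)"
    and dia_trans: "sat R V v (\<^bold>\<diamond> \<gamma>) \<Longrightarrow> R u v \<Longrightarrow> sat R V u (\<^bold>\<diamond> \<gamma>)" for u v \<gamma>
    using assms(2) by (auto dest: transpD)
  have box_witness: "\<not> sat R V w (\<^bold>\<box> \<gamma>) \<Longrightarrow> \<exists>v. R w v \<and> \<not> sat R V v \<gamma>"
    and dia_witness: "sat R V w (\<^bold>\<diamond> \<gamma>) \<Longrightarrow> \<exists>v. R w v \<and> sat R V v \<gamma>" for \<gamma>
    by auto
  \<comment> \<open>Modal formulas stay folded, so that quantifiers over successors enter only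
    through the facts above.\<close>
  note [simp del] = sat.simps(6,7)
  have prems: "\<forall>S'\<in>set Ss. sat_sequent R V w S'"
    using assms(4) by blast
  show ?thesis
    using assms(3)
  proof (cases rule: instance_of.cases)
    case (box_right \<Gamma>\<^sub>1 \<Gamma>\<^sub>2 \<alpha> \<Delta>\<^sub>1 \<Delta>\<^sub>2)
    with assms(4)[of "hd Ss"] show ?thesis
      by (simp add: ball_Un bex_Un) (meson box_trans dia_trans box_witness)
  next
    case (dia_left \<alpha> \<Gamma>\<^sub>1 \<Gamma>\<^sub>2 \<Delta>\<^sub>1 \<Delta>\<^sub>2)
    with assms(4)[of "hd Ss"] show ?thesis
      by (simp add: ball_Un bex_Un) (meson box_trans dia_trans dia_witness)
  next
    case (neg_box_left \<Gamma>\<^sub>1 \<Gamma>\<^sub>2 \<alpha> \<Delta>\<^sub>1 \<Delta>\<^sub>2)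
    with assms(4)[of "hd Ss"] show ?thesis
      by (simp add: ball_Un bex_Un) (meson box_trans dia_trans box_witness)
  next
    case (neg_dia_right \<alpha> \<Gamma>\<^sub>1 \<Gamma>\<^sub>2 \<Delta>\<^sub>1 \<Delta>\<^sub>2)
    with assms(4)[of "hd Ss"] show ?thesis
      by (simp add: ball_Un bex_Un) (meson box_trans dia_trans dia_witness)
  next
    case (box_right_T \<Gamma>\<^sub>1 \<Delta>\<^sub>2 \<alpha> \<Delta>\<^sub>1 \<Gamma>\<^sub>2)
    with assms(4)[of "hd Ss"] show ?thesis
      by (simp add: ball_Un bex_Un) (meson box_trans dia_trans box_witness)
  next
    case (dia_left_T \<alpha> \<Gamma>\<^sub>1 \<Delta>\<^sub>2 \<Delta>\<^sub>1 \<Gamma>\<^sub>2)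
    with assms(4)[of "hd Ss"] show ?thesis
      by (simp add: ball_Un bex_Un) (meson box_trans dia_trans dia_witness)
  next
    case (neg_box_left_T \<Gamma>\<^sub>1 \<Delta>\<^sub>2 \<alpha> \<Delta>\<^sub>1 \<Gamma>\<^sub>2)
    with assms(4)[of "hd Ss"] show ?thesis
      by (simp add: ball_Un bex_Un) (meson box_trans dia_trans box_witness)
  next
    case (neg_dia_right_T \<alpha> \<Gamma>\<^sub>1 \<Delta>\<^sub>2 \<Delta>\<^sub>1 \<Gamma>\<^sub>2)
    with assms(4)[of "hd Ss"] show ?thesis
      by (simp add: ball_Un bex_Un) (meson box_trans dia_trans dia_witness)
  qed (use prems in \<open>auto dest: box_refl intro: dia_refl\<close>)
qed

lemma provable_sound:
  assumes "reflp R" and "transp R" and "provable M S"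
  shows "sat_sequent R V w S"
  using assms(3)
\<comment> \<open>The world is generalised because the restricted modal rules use their premise at a
  successor.\<close>
proof (induction arbitrary: w)
  case (rule r Ss S)
  then show ?case using instance_of_sound[OF assms(1,2) rule.hyps(2)] by blast
qed

lemma provable_mono:
  assumes "M \<subseteq> N" and "provable M S"
  shows "provable N S"
  using assms(2) by induction (use assms(1) in \<open>auto intro: provable.rule\<close>)

section \<open>Maximal non-refutable pairs\<close>

text \<open>The sets may be infinite, but a refutation uses only finite parts of them. This finite
  character is what Zorn's lemma requires.\<close>

definition refutable :: "calculus \<Rightarrow> fm set \<Rightarrow> fm set \<Rightarrow> bool" where
  "refutable M X Y \<longleftrightarrow> (\<exists>\<Gamma> \<Delta>. fset \<Gamma> \<subseteq> X \<and> fset \<Delta> \<subseteq> Y \<and> provable M (\<Gamma> \<^bold>\<Rightarrow> \<Delta>))"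

text \<open>Whether \<open>X\<close> and \<open>Y\<close> together exhaust all formulas is left
  open: the usual argument for that applies (cut).\<close>

definition worlds :: "calculus \<Rightarrow> (fm set \<times> fm set) set" where
  "worlds M = {(X, Y). \<not> refutable M X Y \<and>
    (\<forall>X' Y'. X \<subseteq> X' \<longrightarrow> Y \<subseteq> Y' \<longrightarrow> \<not> refutable M X' Y' \<longrightarrow> X' = X \<and> Y' = Y)}"

lemma world_not_refutable: "(X, Y) \<in> worlds M \<Longrightarrow> \<not> refutable M X Y"
  by (simp add: worlds_def)

text \<open>Used in contrapositive form: formulas missing from a world yield a refutation of the
  pair enlarged by them. They are added together because one premise of a rule may have several
  active formulas.\<close>

lemma world_maximal:
  "(X, Y) \<in> worlds M \<Longrightarrow> \<not> refutable M (fset A \<union> X) (fset C \<union> Y) \<Longrightarrow> fset A \<subseteq> X \<and> fset C \<subseteq> Y"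
  unfolding worlds_def by blast

text \<open>Zorn's lemma applies by finite character: a sequent refuting the union of a chain has
  finitely many formulas, and these all lie in one member of the chain.\<close>

lemma extend_to_world:
  assumes "\<not> refutable M X Y"
  obtains X' Y' where "X \<subseteq> X'" "Y \<subseteq> Y'" "(X', Y') \<in> worlds M"
proof -
  \<comment> \<open>A pair of sets is coded as one subset of the disjoint sum, so that plain
    inclusion compares both components at once.\<close>
  define A where "A = {Z. X <+> Y \<subseteq> Z \<and> \<not> refutable M (Inl -` Z) (Inr -` Z)}"
  have "\<Union>\<C> \<in> A" if "\<C> \<noteq> {}" and chain: "subset.chain A \<C>" for \<C>
  proof (rule ccontr)
    assume "\<Union>\<C> \<notin> A"
    moreover have "X <+> Y \<subseteq> \<Union>\<C>"
      using that by (fastforce simp: A_def subset.chain_def)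
    ultimately obtain \<Gamma> \<Delta> where *: "fset \<Gamma> \<subseteq> Inl -` \<Union>\<C>" "fset \<Delta> \<subseteq> Inr -` \<Union>\<C>" "provable M (\<Gamma> \<^bold>\<Rightarrow> \<Delta>)"
      by (auto simp: A_def refutable_def)
    then have "Inl ` fset \<Gamma> \<union> Inr ` fset \<Delta> \<subseteq> \<Union>\<C>" "finite (Inl ` fset \<Gamma> \<union> Inr ` fset \<Delta>)"
      by auto
    then obtain Z where "Z \<in> \<C>" "Inl ` fset \<Gamma> \<union> Inr ` fset \<Delta> \<subseteq> Z"
      using finite_subset_Union_chain[OF _ _ \<open>\<C> \<noteq> {}\<close> chain] by metis
    then have "fset \<Gamma> \<subseteq> Inl -` Z" "fset \<Delta> \<subseteq> Inr -` Z"
      by auto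
    with *(3) have "Z \<notin> A"
      unfolding A_def refutable_def by blast
    then show False
      using \<open>Z \<in> \<C>\<close> chain by (auto simp: subset.chain_def)
  qed
  moreover have "X <+> Y \<in> A"
  proof -
    have "Inl -` (X <+> Y) = X" "Inr -` (X <+> Y) = Y" by auto
    then show ?thesis using assms by (simp add: A_def)
  qed
  ultimately obtain Z where Z: "Z \<in> A" "\<forall>Z'\<in>A. Z \<subseteq> Z' \<longrightarrow> Z' = Z"
    using subset_Zorn_nonempty[of A] by auto
  show thesis
  proof (rule that)
    show "X \<subseteq> Inl -` Z" "Y \<subseteq> Inr -` Z" using Z(1) by (auto simp: A_def)
    have "X' = Inl -` Z \<and> Y' = Inr -` Z"
      if "Inl -` Z \<subseteq> X'" "Inr -` Z \<subseteq> Y'" "\<not> refutable M X' Y'" for X' Y'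
    proof -
      have eq: "Inl -` (X' <+> Y') = X'" "Inr -` (X' <+> Y') = Y'" by auto
      have "z \<in> X' <+> Y'" if "z \<in> Z" for z
        using that \<open>Inl -` Z \<subseteq> X'\<close> \<open>Inr -` Z \<subseteq> Y'\<close> by (cases z) auto
      then have "Z \<subseteq> X' <+> Y'" by (rule subsetI)
      moreover from this have "X' <+> Y' \<in> A"
        unfolding A_def mem_Collect_eq eq using Z(1) that(3) by (auto simp: A_def)
      ultimately have "X' <+> Y' = Z" using Z(2) by simp
      with eq show ?thesis by blast
    qed
    then show "(Inl -` Z, Inr -` Z) \<in> worlds M"
      using Z(1) by (auto simp: worlds_def A_def)
  qed
qed

text \<open>Brings a finite set of modal formulas into the shape of the context of a modal rule. For
  gTS4 the two maps coincide, and the two parts then record from which side of the world each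
  formula comes.\<close>

lemma fset_subset_image_Un:
  assumes "fset \<Gamma> \<subseteq> f ` A \<union> g ` B"
  obtains \<Gamma>\<^sub>1 \<Gamma>\<^sub>2 where "\<Gamma> = f |`| \<Gamma>\<^sub>1 |\<union>| g |`| \<Gamma>\<^sub>2" "fset \<Gamma>\<^sub>1 \<subseteq> A" "fset \<Gamma>\<^sub>2 \<subseteq> B"
proof -
  from assms have "\<exists>\<Gamma>\<^sub>1 \<Gamma>\<^sub>2. \<Gamma> = f |`| \<Gamma>\<^sub>1 |\<union>| g |`| \<Gamma>\<^sub>2 \<and> fset \<Gamma>\<^sub>1 \<subseteq> A \<and> fset \<Gamma>\<^sub>2 \<subseteq> B"
  proof (induction \<Gamma>)
    case empty
    show ?case by (intro exI[of _ "{||}"]) simp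
  next
    case (insert x \<Gamma>)
    then obtain \<Gamma>\<^sub>1 \<Gamma>\<^sub>2 where IH: "\<Gamma> = f |`| \<Gamma>\<^sub>1 |\<union>| g |`| \<Gamma>\<^sub>2" "fset \<Gamma>\<^sub>1 \<subseteq> A" "fset \<Gamma>\<^sub>2 \<subseteq> B"
      by auto
    from insert.prems consider a where "x = f a" "a \<in> A" | b where "x = g b" "b \<in> B"
      by auto
    then show ?case
    proof cases
      case 1
      with IH show ?thesis by (intro exI[of _ "finsert a \<Gamma>\<^sub>1"] exI[of _ \<Gamma>\<^sub>2]) simp
    next
      case 2
      with IH show ?thesis by (intro exI[of _ \<Gamma>\<^sub>1] exI[of _ "finsert b \<Gamma>\<^sub>2"]) simp
    qed
  qed
  then show thesis using that by blast
qed

section \<open>The canonical model\<close>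

text \<open>The formulas that the pair requires to be true at every successor.\<close>

definition box_content :: "fm set \<times> fm set \<Rightarrow> fm set" where
  "box_content = (\<lambda>(X, Y). {\<gamma>. \<^bold>\<box> \<gamma> \<in> X \<or> \<^bold>\<not> \<^bold>\<box> \<gamma> \<in> Y})"

text \<open>Dually, the formulas that the pair requires to be false at every successor.\<close>

definition dia_content :: "fm set \<times> fm set \<Rightarrow> fm set" where
  "dia_content = (\<lambda>(X, Y). {\<gamma>. \<^bold>\<diamond> \<gamma> \<in> Y \<or> \<^bold>\<not> \<^bold>\<diamond> \<gamma> \<in> X})"

text \<open>The disjunct \<open>w = v\<close> only makes the relation reflexive on pairs that are not worlds.\<close>

definition accessible :: "calculus \<Rightarrow> fm set \<times> fm set \<Rightarrow> fm set \<times> fm set \<Rightarrow> bool" where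
  "accessible M w v \<longleftrightarrow> w = v \<or>
    v \<in> worlds M \<and> box_content w \<subseteq> box_content v \<and> dia_content w \<subseteq> dia_content v"

text \<open>
  A variable absent from both sides may be given any value, but \<open>\<not>p \<in> Y\<close> does not
  entail \<open>p \<in> X\<close> without (cut), so it must be taken into account.
\<close>

definition valuation :: "fm set \<times> fm set \<Rightarrow> nat \<Rightarrow> bool" where
  "valuation = (\<lambda>(X, Y) p. Var p \<in> X \<or> \<^bold>\<not> Var p \<in> Y)"

lemma reflp_accessible: "reflp (accessible M)"
  by (simp add: reflp_def accessible_def)

lemma transp_accessible: "transp (accessible M)"
  unfolding transp_def accessible_def by blast

section \<open>Saturation of worlds under the rules\<close>

text \<open>Both calculi are treated at once. They differ only in four modal rules, and only
  \<open>successor_seed\<close> distinguishes between them.\<close>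

locale cut_free_TS4 =
  fixes M :: calculus
  assumes M: "M = cut_free lTS4 \<or> M = cut_free gTS4"
begin

lemma shared_rules:
  "cut_free lTS4 - {BoxRight, DiaLeft, NegBoxLeft, NegDiaRight} \<subseteq> M"
  using M by (auto simp: cut_free_def gTS4_def)

lemma weakening:
  assumes "provable M (\<Gamma> \<^bold>\<Rightarrow> \<Delta>)" and "\<Gamma> |\<subseteq>| \<Gamma>'" and "\<Delta> |\<subseteq>| \<Delta>'"
  shows "provable M (\<Gamma>' \<^bold>\<Rightarrow> \<Delta>')"
proof -
  have [simp]: "WeLeft \<in> M" "WeRight \<in> M"
    using shared_rules by (auto simp: cut_free_def lTS4_def)
  have "provable M (\<Theta> |\<union>| \<Gamma> \<^bold>\<Rightarrow> \<Delta>)" for \<Theta>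
    by (induction \<Theta>) (auto intro: provable.rule[OF _ we_left] assms(1))
  then have "provable M (\<Theta> |\<union>| \<Gamma> \<^bold>\<Rightarrow> \<Xi> |\<union>| \<Delta>)" for \<Theta> \<Xi>
    by (induction \<Xi>) (auto intro: provable.rule[OF _ we_right])
  from this[of \<Gamma>' \<Delta>'] show ?thesis
    using assms(2,3) by (simp add: sup_absorb1)
qed

text \<open>Weakening restores all of \<open>A\<close> and \<open>C\<close> in the derivation, so
  that they can serve as the active formulas of a premise. What else the derivation uses lies in
  \<open>X\<close> and \<open>Y\<close>.\<close>

lemma refutable_UnE:
  assumes "refutable M (fset A \<union> X) (fset C \<union> Y)"
  obtains \<Gamma> \<Delta> where "fset \<Gamma> \<subseteq> X" "fset \<Delta> \<subseteq> Y" "provable M (A |\<union>| \<Gamma> \<^bold>\<Rightarrow> C |\<union>| \<Delta>)"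
proof -
  from assms obtain \<Gamma> \<Delta> where *: "fset \<Gamma> \<subseteq> fset A \<union> X" "fset \<Delta> \<subseteq> fset C \<union> Y"
    "provable M (\<Gamma> \<^bold>\<Rightarrow> \<Delta>)"
    by (auto simp: refutable_def)
  have "provable M (A |\<union>| (\<Gamma> |-| A) \<^bold>\<Rightarrow> C |\<union>| (\<Delta> |-| C))"
    by (rule weakening[OF *(3)]) auto
  with * show thesis by (intro that[of "\<Gamma> |-| A" "\<Delta> |-| C"]) auto
qed

lemma provable_notin_world:
  assumes "provable M (\<Gamma> \<^bold>\<Rightarrow> \<Delta>)" and "(X, Y) \<in> worlds M" and "fset \<Gamma> \<subseteq> X" and "fset \<Delta> \<subseteq> Y"
  shows False
  using assms world_not_refutable unfolding refutable_def by blast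

text \<open>The list \<open>ps\<close> holds the active formulas of the premises, \<open>A\<close>
  and \<open>C\<close> the principal ones. If the world contained the active formulas of no premise,
  maximality would make every premise derivable in a context taken from the world. Over a common
  context \<open>R\<close> would then derive a sequent inside the world. Since \<open>step\<close>
  must hold for every context, the restricted modal rules are not covered.\<close>

lemma world_saturated_rule:
  assumes "(X, Y) \<in> worlds M" and "fset A \<subseteq> X" and "fset C \<subseteq> Y" and "R \<in> M"
    and step: "\<And>\<Gamma> \<Delta>. instance_of R (map (\<lambda>(A', C'). A' |\<union>| \<Gamma> \<^bold>\<Rightarrow> C' |\<union>| \<Delta>) ps) (A |\<union>| \<Gamma> \<^bold>\<Rightarrow> C |\<union>| \<Delta>)"
  shows "\<exists>(A', C')\<in>set ps. fset A' \<subseteq> X \<and> fset C' \<subseteq> Y"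
proof (rule ccontr)
  assume no_premise: "\<not> ?thesis"
  \<comment> \<open>Each premise comes with its own context. Induction over the premises merges
    these into a single one, weakening the derivations already found.\<close>
  have "\<exists>\<Gamma> \<Delta>. fset \<Gamma> \<subseteq> X \<and> fset \<Delta> \<subseteq> Y \<and> (\<forall>(A', C')\<in>set qs. provable M (A' |\<union>| \<Gamma> \<^bold>\<Rightarrow> C' |\<union>| \<Delta>))"
    if "set qs \<subseteq> set ps" for qs
    using that
  proof (induction qs)
    case Nil
    show ?case by (intro exI[of _ "{||}"]) simp
  next
    case (Cons q qs)
    obtain A' C' where q: "q = (A', C')" by (cases q)
    from Cons obtain \<Gamma>\<^sub>1 \<Delta>\<^sub>1 where IH: "fset \<Gamma>\<^sub>1 \<subseteq> X" "fset \<Delta>\<^sub>1 \<subseteq> Y"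
      "\<forall>(A', C')\<in>set qs. provable M (A' |\<union>| \<Gamma>\<^sub>1 \<^bold>\<Rightarrow> C' |\<union>| \<Delta>\<^sub>1)"
      by auto
    from Cons.prems no_premise q have "refutable M (fset A' \<union> X) (fset C' \<union> Y)"
      using world_maximal[OF assms(1)] by fastforce
    then obtain \<Gamma>\<^sub>2 \<Delta>\<^sub>2 where *: "fset \<Gamma>\<^sub>2 \<subseteq> X" "fset \<Delta>\<^sub>2 \<subseteq> Y" "provable M (A' |\<union>| \<Gamma>\<^sub>2 \<^bold>\<Rightarrow> C' |\<union>| \<Delta>\<^sub>2)"
      by (rule refutable_UnE)
    have "provable M (A'' |\<union>| (\<Gamma>\<^sub>1 |\<union>| \<Gamma>\<^sub>2) \<^bold>\<Rightarrow> C'' |\<union>| (\<Delta>\<^sub>1 |\<union>| \<Delta>\<^sub>2))"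
      if "(A'', C'') \<in> set (q # qs)" for A'' C''
    proof (cases "(A'', C'') \<in> set qs")
      case True
      with IH(3) have "provable M (A'' |\<union>| \<Gamma>\<^sub>1 \<^bold>\<Rightarrow> C'' |\<union>| \<Delta>\<^sub>1)" by auto
      then show ?thesis by (rule weakening) auto
    next
      case False
      with that q have "A'' = A'" "C'' = C'" by auto
      then show ?thesis by (auto intro: weakening[OF *(3)])
    qed
    moreover have "fset (\<Gamma>\<^sub>1 |\<union>| \<Gamma>\<^sub>2) \<subseteq> X" "fset (\<Delta>\<^sub>1 |\<union>| \<Delta>\<^sub>2) \<subseteq> Y"
      using IH(1,2) *(1,2) by auto
    ultimately show ?case by blast
  qed
  from this[OF subset_refl] obtain \<Gamma> \<Delta> where *: "fset \<Gamma> \<subseteq> X" "fset \<Delta> \<subseteq> Y"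
    "\<forall>(A', C')\<in>set ps. provable M (A' |\<union>| \<Gamma> \<^bold>\<Rightarrow> C' |\<union>| \<Delta>)"
    by auto
  have "provable M (A |\<union>| \<Gamma> \<^bold>\<Rightarrow> C |\<union>| \<Delta>)"
    by (rule provable.rule[OF \<open>R \<in> M\<close> step]) (use *(3) in auto)
  then show False
    by (rule provable_notin_world[OF _ assms(1)]) (use *(1,2) assms(2,3) in auto)
qed

text \<open>Each clash would place a derivable initial sequent inside the world. These four are
  exactly the clashes that could conflict with \<open>valuation\<close>.\<close>

lemma world_consistent:
  assumes "(X, Y) \<in> worlds M"
  shows "\<not> (Var p \<in> X \<and> Var p \<in> Y)" "\<not> (\<^bold>\<not> Var p \<in> X \<and> \<^bold>\<not> Var p \<in> Y)"
    "\<not> (\<^bold>\<not> Var p \<in> X \<and> Var p \<in> X)" "\<not> (\<^bold>\<not> Var p \<in> Y \<and> Var p \<in> Y)"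
proof -
  have "{InitPos, InitNeg, InitLeft, InitRight} \<subseteq> M"
    using shared_rules by (auto simp: cut_free_def lTS4_def)
  then have "provable M ({|Var p|} \<^bold>\<Rightarrow> {|Var p|})" "provable M ({|\<^bold>\<not> Var p|} \<^bold>\<Rightarrow> {|\<^bold>\<not> Var p|})"
    "provable M ({|\<^bold>\<not> Var p, Var p|} \<^bold>\<Rightarrow> {||})" "provable M ({||} \<^bold>\<Rightarrow> {|\<^bold>\<not> Var p, Var p|})"
    by (auto intro: provable.rule instance_of.intros(1-4))
  then show "\<not> (Var p \<in> X \<and> Var p \<in> Y)" "\<not> (\<^bold>\<not> Var p \<in> X \<and> \<^bold>\<not> Var p \<in> Y)"
    "\<not> (\<^bold>\<not> Var p \<in> X \<and> Var p \<in> X)" "\<not> (\<^bold>\<not> Var p \<in> Y \<and> Var p \<in> Y)"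
    using provable_notin_world[OF _ assms] by fastforce+
qed

text \<open>Each condition reads a rule upwards: several active formulas in one premise give a
  conjunction, several premises a disjunction. The twist rules decompose a negated compound into
  unnegated subformulas, possibly on the other side. The last two conditions are the canonical
  counterpart of reflexivity.\<close>

lemma world_saturated:
  assumes w: "(X, Y) \<in> worlds M"
  shows
    "\<alpha> \<^bold>\<and> \<beta> \<in> X \<Longrightarrow> \<alpha> \<in> X \<and> \<beta> \<in> X"
    "\<alpha> \<^bold>\<and> \<beta> \<in> Y \<Longrightarrow> \<alpha> \<in> Y \<or> \<beta> \<in> Y"
    "\<alpha> \<^bold>\<or> \<beta> \<in> X \<Longrightarrow> \<alpha> \<in> X \<or> \<beta> \<in> X"
    "\<alpha> \<^bold>\<or> \<beta> \<in> Y \<Longrightarrow> \<alpha> \<in> Y \<and> \<beta> \<in> Y"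
    "\<alpha> \<^bold>\<rightarrow> \<beta> \<in> X \<Longrightarrow> \<alpha> \<in> Y \<or> \<beta> \<in> X"
    "\<alpha> \<^bold>\<rightarrow> \<beta> \<in> Y \<Longrightarrow> \<alpha> \<in> X \<and> \<beta> \<in> Y"
    "\<^bold>\<not> \<^bold>\<not> \<alpha> \<in> X \<Longrightarrow> \<alpha> \<in> X"
    "\<^bold>\<not> \<^bold>\<not> \<alpha> \<in> Y \<Longrightarrow> \<alpha> \<in> Y"
    "\<^bold>\<not> (\<alpha> \<^bold>\<and> \<beta>) \<in> X \<Longrightarrow> \<alpha> \<in> Y \<or> \<beta> \<in> Y"
    "\<^bold>\<not> (\<alpha> \<^bold>\<and> \<beta>) \<in> Y \<Longrightarrow> \<alpha> \<in> X \<and> \<beta> \<in> X"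
    "\<^bold>\<not> (\<alpha> \<^bold>\<or> \<beta>) \<in> X \<Longrightarrow> \<alpha> \<in> Y \<and> \<beta> \<in> Y"
    "\<^bold>\<not> (\<alpha> \<^bold>\<or> \<beta>) \<in> Y \<Longrightarrow> \<alpha> \<in> X \<or> \<beta> \<in> X"
    "\<^bold>\<not> (\<alpha> \<^bold>\<rightarrow> \<beta>) \<in> X \<Longrightarrow> \<alpha> \<in> X \<and> \<beta> \<in> Y"
    "\<^bold>\<not> (\<alpha> \<^bold>\<rightarrow> \<beta>) \<in> Y \<Longrightarrow> \<alpha> \<in> Y \<or> \<beta> \<in> X"
    "\<alpha> \<in> box_content (X, Y) \<Longrightarrow> \<alpha> \<in> X"
    "\<alpha> \<in> dia_content (X, Y) \<Longrightarrow> \<alpha> \<in> Y"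
proof -
  have R: "R \<in> M" if "R \<in> {ConjLeft, ConjRight, DisjLeft, DisjRight, ImpLeft, ImpRight,
      BoxLeft, DiaRight, NegNegLeft, NegNegRight, NegConjLeft, NegConjRight, NegDisjLeft,
      NegDisjRight, NegImpLeft, NegImpRight, NegBoxRight, NegDiaLeft}" for R
    using that shared_rules by (auto simp: cut_free_def lTS4_def)
  show "\<alpha> \<^bold>\<and> \<beta> \<in> X \<Longrightarrow> \<alpha> \<in> X \<and> \<beta> \<in> X"
    using world_saturated_rule[OF w, of "{|\<alpha> \<^bold>\<and> \<beta>|}" "{||}" ConjLeft "[({|\<alpha>, \<beta>|}, {||})]"]
    by (simp add: R conj_left)
  show "\<alpha> \<^bold>\<and> \<beta> \<in> Y \<Longrightarrow> \<alpha> \<in> Y \<or> \<beta> \<in> Y"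
    using world_saturated_rule[OF w, of "{||}" "{|\<alpha> \<^bold>\<and> \<beta>|}" ConjRight "[({||}, {|\<alpha>|}), ({||}, {|\<beta>|})]"]
    by (simp add: R conj_right)
  show "\<alpha> \<^bold>\<or> \<beta> \<in> X \<Longrightarrow> \<alpha> \<in> X \<or> \<beta> \<in> X"
    using world_saturated_rule[OF w, of "{|\<alpha> \<^bold>\<or> \<beta>|}" "{||}" DisjLeft "[({|\<alpha>|}, {||}), ({|\<beta>|}, {||})]"]
    by (simp add: R disj_left)
  show "\<alpha> \<^bold>\<or> \<beta> \<in> Y \<Longrightarrow> \<alpha> \<in> Y \<and> \<beta> \<in> Y"
    using world_saturated_rule[OF w, of "{||}" "{|\<alpha> \<^bold>\<or> \<beta>|}" DisjRight "[({||}, {|\<alpha>, \<beta>|})]"]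
    by (simp add: R disj_right)
  show "\<alpha> \<^bold>\<rightarrow> \<beta> \<in> X \<Longrightarrow> \<alpha> \<in> Y \<or> \<beta> \<in> X"
    using world_saturated_rule[OF w, of "{|\<alpha> \<^bold>\<rightarrow> \<beta>|}" "{||}" ImpLeft "[({||}, {|\<alpha>|}), ({|\<beta>|}, {||})]"]
    by (simp add: R imp_left)
  show "\<alpha> \<^bold>\<rightarrow> \<beta> \<in> Y \<Longrightarrow> \<alpha> \<in> X \<and> \<beta> \<in> Y"
    using world_saturated_rule[OF w, of "{||}" "{|\<alpha> \<^bold>\<rightarrow> \<beta>|}" ImpRight "[({|\<alpha>|}, {|\<beta>|})]"]
    by (simp add: R imp_right)
  show "\<^bold>\<not> \<^bold>\<not> \<alpha> \<in> X \<Longrightarrow> \<alpha> \<in> X"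
    using world_saturated_rule[OF w, of "{|\<^bold>\<not> \<^bold>\<not> \<alpha>|}" "{||}" NegNegLeft "[({|\<alpha>|}, {||})]"]
    by (simp add: R neg_neg_left)
  show "\<^bold>\<not> \<^bold>\<not> \<alpha> \<in> Y \<Longrightarrow> \<alpha> \<in> Y"
    using world_saturated_rule[OF w, of "{||}" "{|\<^bold>\<not> \<^bold>\<not> \<alpha>|}" NegNegRight "[({||}, {|\<alpha>|})]"]
    by (simp add: R neg_neg_right)
  show "\<^bold>\<not> (\<alpha> \<^bold>\<and> \<beta>) \<in> X \<Longrightarrow> \<alpha> \<in> Y \<or> \<beta> \<in> Y"
    using world_saturated_rule[OF w, of "{|\<^bold>\<not> (\<alpha> \<^bold>\<and> \<beta>)|}" "{||}" NegConjLeft "[({||}, {|\<alpha>|}), ({||}, {|\<beta>|})]"]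
    by (simp add: R neg_conj_left)
  show "\<^bold>\<not> (\<alpha> \<^bold>\<and> \<beta>) \<in> Y \<Longrightarrow> \<alpha> \<in> X \<and> \<beta> \<in> X"
    using world_saturated_rule[OF w, of "{||}" "{|\<^bold>\<not> (\<alpha> \<^bold>\<and> \<beta>)|}" NegConjRight "[({|\<alpha>, \<beta>|}, {||})]"]
    by (simp add: R neg_conj_right)
  show "\<^bold>\<not> (\<alpha> \<^bold>\<or> \<beta>) \<in> X \<Longrightarrow> \<alpha> \<in> Y \<and> \<beta> \<in> Y"
    using world_saturated_rule[OF w, of "{|\<^bold>\<not> (\<alpha> \<^bold>\<or> \<beta>)|}" "{||}" NegDisjLeft "[({||}, {|\<alpha>, \<beta>|})]"]
    by (simp add: R neg_disj_left)
  show "\<^bold>\<not> (\<alpha> \<^bold>\<or> \<beta>) \<in> Y \<Longrightarrow> \<alpha> \<in> X \<or> \<beta> \<in> X"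
    using world_saturated_rule[OF w, of "{||}" "{|\<^bold>\<not> (\<alpha> \<^bold>\<or> \<beta>)|}" NegDisjRight "[({|\<alpha>|}, {||}), ({|\<beta>|}, {||})]"]
    by (simp add: R neg_disj_right)
  show "\<^bold>\<not> (\<alpha> \<^bold>\<rightarrow> \<beta>) \<in> X \<Longrightarrow> \<alpha> \<in> X \<and> \<beta> \<in> Y"
    using world_saturated_rule[OF w, of "{|\<^bold>\<not> (\<alpha> \<^bold>\<rightarrow> \<beta>)|}" "{||}" NegImpLeft "[({|\<alpha>|}, {|\<beta>|})]"]
    by (simp add: R neg_imp_left)
  show "\<^bold>\<not> (\<alpha> \<^bold>\<rightarrow> \<beta>) \<in> Y \<Longrightarrow> \<alpha> \<in> Y \<or> \<beta> \<in> X"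
    using world_saturated_rule[OF w, of "{||}" "{|\<^bold>\<not> (\<alpha> \<^bold>\<rightarrow> \<beta>)|}" NegImpRight "[({||}, {|\<alpha>|}), ({|\<beta>|}, {||})]"]
    by (simp add: R neg_imp_right)
  have "\<^bold>\<box> \<alpha> \<in> X \<Longrightarrow> \<alpha> \<in> X"
    using world_saturated_rule[OF w, of "{|\<^bold>\<box> \<alpha>|}" "{||}" BoxLeft "[({|\<alpha>|}, {||})]"]
    by (simp add: R box_left)
  moreover have "\<^bold>\<not> \<^bold>\<box> \<alpha> \<in> Y \<Longrightarrow> \<alpha> \<in> X"
    using world_saturated_rule[OF w, of "{||}" "{|\<^bold>\<not> \<^bold>\<box> \<alpha>|}" NegBoxRight "[({|\<alpha>|}, {||})]"]
    by (simp add: R neg_box_right)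
  ultimately show "\<alpha> \<in> box_content (X, Y) \<Longrightarrow> \<alpha> \<in> X"
    by (auto simp: box_content_def)
  have "\<^bold>\<diamond> \<alpha> \<in> Y \<Longrightarrow> \<alpha> \<in> Y"
    using world_saturated_rule[OF w, of "{||}" "{|\<^bold>\<diamond> \<alpha>|}" DiaRight "[({||}, {|\<alpha>|})]"]
    by (simp add: R dia_right)
  moreover have "\<^bold>\<not> \<^bold>\<diamond> \<alpha> \<in> X \<Longrightarrow> \<alpha> \<in> Y"
    using world_saturated_rule[OF w, of "{|\<^bold>\<not> \<^bold>\<diamond> \<alpha>|}" "{||}" NegDiaLeft "[({||}, {|\<alpha>|})]"]
    by (simp add: R neg_dia_left)
  ultimately show "\<alpha> \<in> dia_content (X, Y) \<Longrightarrow> \<alpha> \<in> Y"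
    by (auto simp: dia_content_def)
qed

section \<open>Existence of successors\<close>

text \<open>The seed is the largest premise context that a restricted modal rule can have when the
  context of its conclusion lies in the world. If adding \<alpha> made the seed refutable, the rule
  would derive a sequent inside the world, with the given modal formula as principal
  formula.\<close>

lemma successor_seed:
  assumes "(X, Y) \<in> worlds M"
  obtains X\<^sub>0 Y\<^sub>0 where
    "box_content (X, Y) \<subseteq> box_content (X\<^sub>0, Y\<^sub>0)" "dia_content (X, Y) \<subseteq> dia_content (X\<^sub>0, Y\<^sub>0)"
    "\<And>\<alpha>. \<^bold>\<box> \<alpha> \<in> Y \<or> \<^bold>\<not> \<^bold>\<box> \<alpha> \<in> X \<Longrightarrow> \<not> refutable M (fset {||} \<union> X\<^sub>0) (fset {|\<alpha>|} \<union> Y\<^sub>0)"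
    "\<And>\<alpha>. \<^bold>\<diamond> \<alpha> \<in> X \<or> \<^bold>\<not> \<^bold>\<diamond> \<alpha> \<in> Y \<Longrightarrow> \<not> refutable M (fset {|\<alpha>|} \<union> X\<^sub>0) (fset {||} \<union> Y\<^sub>0)"
proof -
  consider (lTS4) "M = cut_free lTS4" | (gTS4) "M = cut_free gTS4"
    using M by blast
  then show thesis
  proof cases
    case lTS4
    have R: "R \<in> M" if "R \<in> {BoxRight, DiaLeft, NegBoxLeft, NegDiaRight}" for R
      using that lTS4 by (auto simp: cut_free_def lTS4_def)
    \<comment> \<open>In lTS4 premise and conclusion share their context, so the modal formulas of
      the world are copied to the same side.\<close>
    let ?X = "Box ` {\<gamma>. \<^bold>\<box> \<gamma> \<in> X} \<union> (\<lambda>\<gamma>. \<^bold>\<not> \<^bold>\<diamond> \<gamma>) ` {\<gamma>. \<^bold>\<not> \<^bold>\<diamond> \<gamma> \<in> X}"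
    let ?Y = "Dia ` {\<gamma>. \<^bold>\<diamond> \<gamma> \<in> Y} \<union> (\<lambda>\<gamma>. \<^bold>\<not> \<^bold>\<box> \<gamma>) ` {\<gamma>. \<^bold>\<not> \<^bold>\<box> \<gamma> \<in> Y}"
    show thesis
    proof (rule that)
      show "box_content (X, Y) \<subseteq> box_content (?X, ?Y)" "dia_content (X, Y) \<subseteq> dia_content (?X, ?Y)"
        by (auto simp: box_content_def dia_content_def)
    next
      fix \<alpha> assume \<alpha>: "\<^bold>\<box> \<alpha> \<in> Y \<or> \<^bold>\<not> \<^bold>\<box> \<alpha> \<in> X"
      show "\<not> refutable M (fset {||} \<union> ?X) (fset {|\<alpha>|} \<union> ?Y)"
      proof
        assume "refutable M (fset {||} \<union> ?X) (fset {|\<alpha>|} \<union> ?Y)"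
        then obtain \<Gamma> \<Delta> where *: "fset \<Gamma> \<subseteq> ?X" "fset \<Delta> \<subseteq> ?Y"
          "provable M ({||} |\<union>| \<Gamma> \<^bold>\<Rightarrow> {|\<alpha>|} |\<union>| \<Delta>)"
          by (rule refutable_UnE)
        obtain \<Gamma>\<^sub>1 \<Gamma>\<^sub>2 where \<Gamma>: "\<Gamma> = boxes \<Gamma>\<^sub>1 |\<union>| (\<lambda>\<gamma>. \<^bold>\<not> \<^bold>\<diamond> \<gamma>) |`| \<Gamma>\<^sub>2"
          "fset \<Gamma>\<^sub>1 \<subseteq> {\<gamma>. \<^bold>\<box> \<gamma> \<in> X}" "fset \<Gamma>\<^sub>2 \<subseteq> {\<gamma>. \<^bold>\<not> \<^bold>\<diamond> \<gamma> \<in> X}"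
          using *(1) by (rule fset_subset_image_Un)
        obtain \<Delta>\<^sub>1 \<Delta>\<^sub>2 where \<Delta>: "\<Delta> = dias \<Delta>\<^sub>1 |\<union>| (\<lambda>\<gamma>. \<^bold>\<not> \<^bold>\<box> \<gamma>) |`| \<Delta>\<^sub>2"
          "fset \<Delta>\<^sub>1 \<subseteq> {\<gamma>. \<^bold>\<diamond> \<gamma> \<in> Y}" "fset \<Delta>\<^sub>2 \<subseteq> {\<gamma>. \<^bold>\<not> \<^bold>\<box> \<gamma> \<in> Y}"
          using *(2) by (rule fset_subset_image_Un)
        from \<alpha> show False
        proof
          assume principal: "\<^bold>\<box> \<alpha> \<in> Y"
          have "provable M (boxes \<Gamma>\<^sub>1 |\<union>| neg_dias \<Gamma>\<^sub>2 \<^bold>\<Rightarrow> finsert (\<^bold>\<box> \<alpha>) (dias \<Delta>\<^sub>1 |\<union>| neg_boxes \<Delta>\<^sub>2))"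
            by (rule provable.rule[OF R box_right]) (use * \<Gamma> \<Delta> in auto)
          then show False
            by (rule provable_notin_world[OF _ assms]) (use principal \<Gamma> \<Delta> in auto)
        next
          assume principal: "\<^bold>\<not> \<^bold>\<box> \<alpha> \<in> X"
          have "provable M (finsert (\<^bold>\<not> \<^bold>\<box> \<alpha>) (boxes \<Gamma>\<^sub>1 |\<union>| neg_dias \<Gamma>\<^sub>2) \<^bold>\<Rightarrow> dias \<Delta>\<^sub>1 |\<union>| neg_boxes \<Delta>\<^sub>2)"
            by (rule provable.rule[OF R neg_box_left]) (use * \<Gamma> \<Delta> in auto)
          then show False
            by (rule provable_notin_world[OF _ assms]) (use principal \<Gamma> \<Delta> in auto)
        qed
      qed
    next
      fix \<alpha> assume \<alpha>: "\<^bold>\<diamond> \<alpha> \<in> X \<or> \<^bold>\<not> \<^bold>\<diamond> \<alpha> \<in> Y"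
      show "\<not> refutable M (fset {|\<alpha>|} \<union> ?X) (fset {||} \<union> ?Y)"
      proof
        assume "refutable M (fset {|\<alpha>|} \<union> ?X) (fset {||} \<union> ?Y)"
        then obtain \<Gamma> \<Delta> where *: "fset \<Gamma> \<subseteq> ?X" "fset \<Delta> \<subseteq> ?Y"
          "provable M ({|\<alpha>|} |\<union>| \<Gamma> \<^bold>\<Rightarrow> {||} |\<union>| \<Delta>)"
          by (rule refutable_UnE)
        obtain \<Gamma>\<^sub>1 \<Gamma>\<^sub>2 where \<Gamma>: "\<Gamma> = boxes \<Gamma>\<^sub>1 |\<union>| (\<lambda>\<gamma>. \<^bold>\<not> \<^bold>\<diamond> \<gamma>) |`| \<Gamma>\<^sub>2"
          "fset \<Gamma>\<^sub>1 \<subseteq> {\<gamma>. \<^bold>\<box> \<gamma> \<in> X}" "fset \<Gamma>\<^sub>2 \<subseteq> {\<gamma>. \<^bold>\<not> \<^bold>\<diamond> \<gamma> \<in> X}"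
          using *(1) by (rule fset_subset_image_Un)
        obtain \<Delta>\<^sub>1 \<Delta>\<^sub>2 where \<Delta>: "\<Delta> = dias \<Delta>\<^sub>1 |\<union>| (\<lambda>\<gamma>. \<^bold>\<not> \<^bold>\<box> \<gamma>) |`| \<Delta>\<^sub>2"
          "fset \<Delta>\<^sub>1 \<subseteq> {\<gamma>. \<^bold>\<diamond> \<gamma> \<in> Y}" "fset \<Delta>\<^sub>2 \<subseteq> {\<gamma>. \<^bold>\<not> \<^bold>\<box> \<gamma> \<in> Y}"
          using *(2) by (rule fset_subset_image_Un)
        from \<alpha> show False
        proof
          assume principal: "\<^bold>\<diamond> \<alpha> \<in> X"
          have "provable M (finsert (\<^bold>\<diamond> \<alpha>) (boxes \<Gamma>\<^sub>1 |\<union>| neg_dias \<Gamma>\<^sub>2) \<^bold>\<Rightarrow> dias \<Delta>\<^sub>1 |\<union>| neg_boxes \<Delta>\<^sub>2)"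
            by (rule provable.rule[OF R dia_left]) (use * \<Gamma> \<Delta> in auto)
          then show False
            by (rule provable_notin_world[OF _ assms]) (use principal \<Gamma> \<Delta> in auto)
        next
          assume principal: "\<^bold>\<not> \<^bold>\<diamond> \<alpha> \<in> Y"
          have "provable M (boxes \<Gamma>\<^sub>1 |\<union>| neg_dias \<Gamma>\<^sub>2 \<^bold>\<Rightarrow> finsert (\<^bold>\<not> \<^bold>\<diamond> \<alpha>) (dias \<Delta>\<^sub>1 |\<union>| neg_boxes \<Delta>\<^sub>2))"
            by (rule provable.rule[OF R neg_dia_right]) (use * \<Gamma> \<Delta> in auto)
          then show False
            by (rule provable_notin_world[OF _ assms]) (use principal \<Gamma> \<Delta> in auto)
        qed
      qed
    qed
  next
    case gTS4
    have R: "R \<in> M" if "R \<in> {BoxRightT, DiaLeftT, NegBoxLeftT, NegDiaRightT}" for R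
      using that gTS4 by (auto simp: cut_free_def gTS4_def)
    \<comment> \<open>In gTS4 the negated modal formulas lose their negation and change sides on the
      way to the premise. Both contents are preserved all the same.\<close>
    let ?X = "Box ` {\<gamma>. \<^bold>\<box> \<gamma> \<in> X} \<union> Box ` {\<gamma>. \<^bold>\<not> \<^bold>\<box> \<gamma> \<in> Y}"
    let ?Y = "Dia ` {\<gamma>. \<^bold>\<diamond> \<gamma> \<in> Y} \<union> Dia ` {\<gamma>. \<^bold>\<not> \<^bold>\<diamond> \<gamma> \<in> X}"
    show thesis
    proof (rule that)
      show "box_content (X, Y) \<subseteq> box_content (?X, ?Y)" "dia_content (X, Y) \<subseteq> dia_content (?X, ?Y)"
        by (auto simp: box_content_def dia_content_def)
    next
      fix \<alpha> assume \<alpha>: "\<^bold>\<box> \<alpha> \<in> Y \<or> \<^bold>\<not> \<^bold>\<box> \<alpha> \<in> X"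
      show "\<not> refutable M (fset {||} \<union> ?X) (fset {|\<alpha>|} \<union> ?Y)"
      proof
        assume "refutable M (fset {||} \<union> ?X) (fset {|\<alpha>|} \<union> ?Y)"
        then obtain \<Gamma> \<Delta> where *: "fset \<Gamma> \<subseteq> ?X" "fset \<Delta> \<subseteq> ?Y"
          "provable M ({||} |\<union>| \<Gamma> \<^bold>\<Rightarrow> {|\<alpha>|} |\<union>| \<Delta>)"
          by (rule refutable_UnE)
        obtain \<Gamma>\<^sub>1 \<Gamma>\<^sub>2 where \<Gamma>: "\<Gamma> = boxes \<Gamma>\<^sub>1 |\<union>| Box |`| \<Gamma>\<^sub>2"
          "fset \<Gamma>\<^sub>1 \<subseteq> {\<gamma>. \<^bold>\<box> \<gamma> \<in> X}" "fset \<Gamma>\<^sub>2 \<subseteq> {\<gamma>. \<^bold>\<not> \<^bold>\<box> \<gamma> \<in> Y}"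
          using *(1) by (rule fset_subset_image_Un)
        obtain \<Delta>\<^sub>1 \<Delta>\<^sub>2 where \<Delta>: "\<Delta> = dias \<Delta>\<^sub>1 |\<union>| Dia |`| \<Delta>\<^sub>2"
          "fset \<Delta>\<^sub>1 \<subseteq> {\<gamma>. \<^bold>\<diamond> \<gamma> \<in> Y}" "fset \<Delta>\<^sub>2 \<subseteq> {\<gamma>. \<^bold>\<not> \<^bold>\<diamond> \<gamma> \<in> X}"
          using *(2) by (rule fset_subset_image_Un)
        from \<alpha> show False
        proof
          assume principal: "\<^bold>\<box> \<alpha> \<in> Y"
          \<comment> \<open>The second parts cross over: \<open>\<Gamma>\<^sub>2\<close> comes from
            \<not>\<box>\<gamma> in \<open>Y\<close> and returns on the right, while
            \<open>\<Delta>\<^sub>2\<close> comes from \<not>\<diamond>\<gamma> in \<open>X\<close>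
            and returns on the left.\<close>
          have "provable M (boxes \<Gamma>\<^sub>1 |\<union>| neg_dias \<Delta>\<^sub>2 \<^bold>\<Rightarrow> finsert (\<^bold>\<box> \<alpha>) (dias \<Delta>\<^sub>1 |\<union>| neg_boxes \<Gamma>\<^sub>2))"
            by (rule provable.rule[OF R box_right_T]) (use * \<Gamma> \<Delta> in auto)
          then show False
            by (rule provable_notin_world[OF _ assms]) (use principal \<Gamma> \<Delta> in auto)
        next
          assume principal: "\<^bold>\<not> \<^bold>\<box> \<alpha> \<in> X"
          have "provable M (finsert (\<^bold>\<not> \<^bold>\<box> \<alpha>) (boxes \<Gamma>\<^sub>1 |\<union>| neg_dias \<Delta>\<^sub>2) \<^bold>\<Rightarrow> dias \<Delta>\<^sub>1 |\<union>| neg_boxes \<Gamma>\<^sub>2)"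
            by (rule provable.rule[OF R neg_box_left_T]) (use * \<Gamma> \<Delta> in auto)
          then show False
            by (rule provable_notin_world[OF _ assms]) (use principal \<Gamma> \<Delta> in auto)
        qed
      qed
    next
      fix \<alpha> assume \<alpha>: "\<^bold>\<diamond> \<alpha> \<in> X \<or> \<^bold>\<not> \<^bold>\<diamond> \<alpha> \<in> Y"
      show "\<not> refutable M (fset {|\<alpha>|} \<union> ?X) (fset {||} \<union> ?Y)"
      proof
        assume "refutable M (fset {|\<alpha>|} \<union> ?X) (fset {||} \<union> ?Y)"
        then obtain \<Gamma> \<Delta> where *: "fset \<Gamma> \<subseteq> ?X" "fset \<Delta> \<subseteq> ?Y"
          "provable M ({|\<alpha>|} |\<union>| \<Gamma> \<^bold>\<Rightarrow> {||} |\<union>| \<Delta>)"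
          by (rule refutable_UnE)
        obtain \<Gamma>\<^sub>1 \<Gamma>\<^sub>2 where \<Gamma>: "\<Gamma> = boxes \<Gamma>\<^sub>1 |\<union>| Box |`| \<Gamma>\<^sub>2"
          "fset \<Gamma>\<^sub>1 \<subseteq> {\<gamma>. \<^bold>\<box> \<gamma> \<in> X}" "fset \<Gamma>\<^sub>2 \<subseteq> {\<gamma>. \<^bold>\<not> \<^bold>\<box> \<gamma> \<in> Y}"
          using *(1) by (rule fset_subset_image_Un)
        obtain \<Delta>\<^sub>1 \<Delta>\<^sub>2 where \<Delta>: "\<Delta> = dias \<Delta>\<^sub>1 |\<union>| Dia |`| \<Delta>\<^sub>2"
          "fset \<Delta>\<^sub>1 \<subseteq> {\<gamma>. \<^bold>\<diamond> \<gamma> \<in> Y}" "fset \<Delta>\<^sub>2 \<subseteq> {\<gamma>. \<^bold>\<not> \<^bold>\<diamond> \<gamma> \<in> X}"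
          using *(2) by (rule fset_subset_image_Un)
        from \<alpha> show False
        proof
          assume principal: "\<^bold>\<diamond> \<alpha> \<in> X"
          have "provable M (finsert (\<^bold>\<diamond> \<alpha>) (boxes \<Gamma>\<^sub>1 |\<union>| neg_dias \<Delta>\<^sub>2) \<^bold>\<Rightarrow> dias \<Delta>\<^sub>1 |\<union>| neg_boxes \<Gamma>\<^sub>2)"
            by (rule provable.rule[OF R dia_left_T]) (use * \<Gamma> \<Delta> in auto)
          then show False
            by (rule provable_notin_world[OF _ assms]) (use principal \<Gamma> \<Delta> in auto)
        next
          assume principal: "\<^bold>\<not> \<^bold>\<diamond> \<alpha> \<in> Y"
          have "provable M (boxes \<Gamma>\<^sub>1 |\<union>| neg_dias \<Delta>\<^sub>2 \<^bold>\<Rightarrow> finsert (\<^bold>\<not> \<^bold>\<diamond> \<alpha>) (dias \<Delta>\<^sub>1 |\<union>| neg_boxes \<Gamma>\<^sub>2))"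
            by (rule provable.rule[OF R neg_dia_right_T]) (use * \<Gamma> \<Delta> in auto)
          then show False
            by (rule provable_notin_world[OF _ assms]) (use principal \<Gamma> \<Delta> in auto)
        qed
      qed
    qed
  qed
qed

text \<open>Both contents grow with the pair, so a world extending the seed is still accessible from
  \<open>w\<close>.\<close>

lemma world_successor:
  assumes "\<not> refutable M (fset A \<union> X\<^sub>0) (fset C \<union> Y\<^sub>0)"
    and "box_content w \<subseteq> box_content (X\<^sub>0, Y\<^sub>0)" and "dia_content w \<subseteq> dia_content (X\<^sub>0, Y\<^sub>0)"
  obtains X' Y' where "(X', Y') \<in> worlds M" "accessible M w (X', Y')" "fset A \<subseteq> X'" "fset C \<subseteq> Y'"
proof -
  obtain X' Y' where *: "fset A \<union> X\<^sub>0 \<subseteq> X'" "fset C \<union> Y\<^sub>0 \<subseteq> Y'" "(X', Y') \<in> worlds M"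
    using extend_to_world[OF assms(1)] .
  moreover from * have "box_content (X\<^sub>0, Y\<^sub>0) \<subseteq> box_content (X', Y')"
    "dia_content (X\<^sub>0, Y\<^sub>0) \<subseteq> dia_content (X', Y')"
    by (auto simp: box_content_def dia_content_def)
  ultimately show thesis
    using assms(2,3) by (intro that[of X' Y']) (auto simp: accessible_def)
qed

lemma box_successor:
  assumes "(X, Y) \<in> worlds M" and "\<^bold>\<box> \<alpha> \<in> Y \<or> \<^bold>\<not> \<^bold>\<box> \<alpha> \<in> X"
  obtains X' Y' where "(X', Y') \<in> worlds M" "accessible M (X, Y) (X', Y')" "\<alpha> \<in> Y'"
proof -
  obtain X\<^sub>0 Y\<^sub>0 where "box_content (X, Y) \<subseteq> box_content (X\<^sub>0, Y\<^sub>0)"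
    "dia_content (X, Y) \<subseteq> dia_content (X\<^sub>0, Y\<^sub>0)"
    "\<not> refutable M (fset {||} \<union> X\<^sub>0) (fset {|\<alpha>|} \<union> Y\<^sub>0)"
    using successor_seed[OF assms(1)] assms(2) by metis
  then show thesis
    using world_successor[of "{||}" X\<^sub>0 "{|\<alpha>|}" Y\<^sub>0 "(X, Y)"] that by auto
qed

lemma dia_successor:
  assumes "(X, Y) \<in> worlds M" and "\<^bold>\<diamond> \<alpha> \<in> X \<or> \<^bold>\<not> \<^bold>\<diamond> \<alpha> \<in> Y"
  obtains X' Y' where "(X', Y') \<in> worlds M" "accessible M (X, Y) (X', Y')" "\<alpha> \<in> X'"
proof -
  obtain X\<^sub>0 Y\<^sub>0 where "box_content (X, Y) \<subseteq> box_content (X\<^sub>0, Y\<^sub>0)"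
    "dia_content (X, Y) \<subseteq> dia_content (X\<^sub>0, Y\<^sub>0)"
    "\<not> refutable M (fset {|\<alpha>|} \<union> X\<^sub>0) (fset {||} \<union> Y\<^sub>0)"
    using successor_seed[OF assms(1)] assms(2) by metis
  then show thesis
    using world_successor[of "{|\<alpha>|}" X\<^sub>0 "{||}" Y\<^sub>0 "(X, Y)"] that by auto
qed

text \<open>Accessibility compares contents with contents; saturation of the target world then puts
  its own contents into its two sides.\<close>

lemma accessible_world:
  assumes "accessible M (X, Y) v" and "(X, Y) \<in> worlds M"
  shows "v \<in> worlds M" "box_content (X, Y) \<subseteq> fst v" "dia_content (X, Y) \<subseteq> snd v"
proof -
  obtain X' Y' where v: "v = (X', Y')" by (cases v)
  show "v \<in> worlds M" using assms by (auto simp: accessible_def)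
  then show "box_content (X, Y) \<subseteq> fst v" "dia_content (X, Y) \<subseteq> snd v"
    using assms(1) world_saturated(15,16)[of X' Y'] unfolding v accessible_def by auto
qed

section \<open>Truth lemma and completeness\<close>

text \<open>The claim covers \<not>\<phi> along with \<phi>, because the twist rules take
  \<not>\<phi> apart into subformulas of \<phi>; induction on \<phi> can then use these
  directly.\<close>

lemma truth_lemma:
  assumes "(X, Y) \<in> worlds M"
  shows "(\<phi> \<in> X \<or> \<^bold>\<not> \<phi> \<in> Y \<longrightarrow> sat (accessible M) valuation (X, Y) \<phi>) \<and>
    (\<phi> \<in> Y \<or> \<^bold>\<not> \<phi> \<in> X \<longrightarrow> \<not> sat (accessible M) valuation (X, Y) \<phi>)"
  using assms
proof (induction \<phi> arbitrary: X Y)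
  case (Var p)
  then show ?case using world_consistent[of X Y p] by (auto simp: valuation_def)
next
  case (Conj \<alpha> \<beta>)
  then show ?case using world_saturated(1,2,9,10)[of X Y \<alpha> \<beta>] by auto
next
  case (Disj \<alpha> \<beta>)
  then show ?case using world_saturated(3,4,11,12)[of X Y \<alpha> \<beta>] by auto
next
  case (Imp \<alpha> \<beta>)
  then show ?case using world_saturated(5,6,13,14)[of X Y \<alpha> \<beta>] by auto
next
  case (Neg \<alpha>)
  \<comment> \<open>The induction hypothesis for \<alpha> already speaks of \<not>\<alpha>; only
    \<not>\<not>\<alpha> has to be reduced by saturation.\<close>
  then show ?case using world_saturated(7,8)[of X Y \<alpha>] by auto
next
  case (Box \<alpha>)
  \<comment> \<open>Either membership puts \<alpha> into the box content of the world, hence on the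
    left of every accessible world.\<close>
  have "sat (accessible M) valuation v \<alpha>"
    if "\<^bold>\<box> \<alpha> \<in> X \<or> \<^bold>\<not> \<^bold>\<box> \<alpha> \<in> Y" "accessible M (X, Y) v" for v
    using that accessible_world[OF that(2) Box.prems] Box.IH[of "fst v" "snd v"]
    by (auto simp: box_content_def)
  moreover have "\<exists>v. accessible M (X, Y) v \<and> \<not> sat (accessible M) valuation v \<alpha>"
    if "\<^bold>\<box> \<alpha> \<in> Y \<or> \<^bold>\<not> \<^bold>\<box> \<alpha> \<in> X"
    using box_successor[OF Box.prems that] Box.IH by metis
  ultimately show ?case by auto
next
  case (Dia \<alpha>)
  have "\<not> sat (accessible M) valuation v \<alpha>"
    if "\<^bold>\<diamond> \<alpha> \<in> Y \<or> \<^bold>\<not> \<^bold>\<diamond> \<alpha> \<in> X" "accessible M (X, Y) v" for v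
    using that accessible_world[OF that(2) Dia.prems] Dia.IH[of "fst v" "snd v"]
    by (auto simp: dia_content_def)
  moreover have "\<exists>v. accessible M (X, Y) v \<and> sat (accessible M) valuation v \<alpha>"
    if "\<^bold>\<diamond> \<alpha> \<in> X \<or> \<^bold>\<not> \<^bold>\<diamond> \<alpha> \<in> Y"
    using dia_successor[OF Dia.prems that] Dia.IH by metis
  ultimately show ?case by auto
qed

text \<open>By weakening, an underivable sequent is a non-refutable pair. It extends to a world, and
  there the truth lemma makes its left side true and its right side false.\<close>

lemma complete:
  assumes "\<And>w. sat_sequent (accessible M) valuation w (\<Gamma> \<^bold>\<Rightarrow> \<Delta>)"
  shows "provable M (\<Gamma> \<^bold>\<Rightarrow> \<Delta>)"
proof (rule ccontr)
  assume not_provable: "\<not> provable M (\<Gamma> \<^bold>\<Rightarrow> \<Delta>)"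
  have "\<not> refutable M (fset \<Gamma>) (fset \<Delta>)"
  proof
    assume "refutable M (fset \<Gamma>) (fset \<Delta>)"
    then obtain \<Gamma>' \<Delta>' where "fset \<Gamma>' \<subseteq> fset \<Gamma>" "fset \<Delta>' \<subseteq> fset \<Delta>" "provable M (\<Gamma>' \<^bold>\<Rightarrow> \<Delta>')"
      by (auto simp: refutable_def)
    then show False using weakening not_provable by (simp add: less_eq_fset.rep_eq)
  qed
  then obtain X Y where "fset \<Gamma> \<subseteq> X" "fset \<Delta> \<subseteq> Y" "(X, Y) \<in> worlds M"
    by (rule extend_to_world)
  then show False
    using truth_lemma assms[of "(X, Y)"] unfolding sat_sequent.simps by blast
qed

end

section \<open>From completeness to the admissibility of (cut)\<close>

theorem theorem4p4:
  fixes L :: calculus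
  assumes "L = lTS4 \<or> L = gTS4"
  shows "admissible Cut (cut_free L) \<and> (\<forall>S. provable L S \<longrightarrow> provable (cut_free L) S)"
proof -
  interpret cut_free_TS4 "cut_free L"
    using assms by unfold_locales auto
  \<comment> \<open>Soundness of \<open>L\<close>, including (cut), makes the sequent valid in the
    model built from \<open>cut_free L\<close>; completeness turns this into a proof without
    (cut).\<close>
  have elim: "provable (cut_free L) S" if "provable L S" for S
    using that complete provable_sound[OF reflp_accessible transp_accessible that]
    by (cases S) blast
  have "Cut \<in> L"
    using assms by (auto simp: lTS4_def gTS4_def)
  \<comment> \<open>Premises provable without (cut) are provable in \<open>L\<close>. One
    application of (cut) gives the conclusion in \<open>L\<close>, and \<open>elim\<close> returns
    to \<open>cut_free L\<close>.\<close>
  then have "admissible Cut (cut_free L)"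
    unfolding admissible_def
    by (metis elim provable.rule provable_mono[of "cut_free L" L] cut_free_def Diff_subset)
  with elim show ?thesis by blast
qed

end
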